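(* For each $z\in\mathbb{C}_\infty$, the following identity holds in $\mathbb{T}$: \[ f_C(\tilde\pi z;t)=\omega(t)\sum_{j\ge0}b_j(t)E_j(z). \]
   Context: $A=\mathbb{F}_q[\theta]$; $\mathbb{C}_\infty$ the completion of an algebraic closure of the completion of $\mathbb{F}_q(\theta)$ for $|\theta|=q$; $\mathbb{T}$ the Tate algebra of power series in $t$ over $\mathbb{C}_\infty$ converging on $|t|\le 1$. $D_j$ is the product of the monic polynomials of degree $j$ in $A$; $e_C(z)=\sum_{j\ge0}z^{q^j}/D_j$. Fix $\iota$ with $\iota^{q-1}=-\theta$; $\tilde\pi=\iota\theta\prod_{j\ge1}(1-\theta/\theta^{q^j})^{-1}$, $\omega(t)=\iota\prod_{j\ge0}(1-t/\theta^{q^j})^{-1}$. The Anderson generating function is $f_C(z;t)=\sum_{j\ge0}e_C(z/\theta^{j+1})t^j=\sum_{j\ge0}\frac{z^{q^j}}{D_j(\theta^{q^j}-t)}$. $b_j(t)=\prod_{i=0}^{j-1}(t-\theta^{q^i})$; $A(d)$ is the set of elements of $A$ of degree $<d$ ($A(0)=\{0\}$); $E_d(z)=D_d^{-1}\prod_{a\in A(d)}(z-a)$. The series $\sum_j b_j(t)E_j(z)$ converges in $\mathbb{T}$. *)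

theory Defs
  imports "HOL-Computational_Algebra.Polynomial"
begin

text \<open>The field C_infinity is modelled by a field type 'a equipped with an absolute
value v, characterised (up to isometric isomorphism) by: characteristic p, v is a
non-archimedean absolute value with v theta = q, 'a is complete and algebraically
closed, and the elements algebraic over A = F_q[theta] are dense.\<close>

definition is_nonarch_abs :: "('a::field \<Rightarrow> real) \<Rightarrow> bool" where
  "is_nonarch_abs v \<longleftrightarrow> (\<forall>x. 0 \<le> v x) \<and> (\<forall>x. v x = 0 \<longleftrightarrow> x = 0) \<and>
     (\<forall>x y. v (x * y) = v x * v y) \<and> (\<forall>x y. v (x + y) \<le> max (v x) (v y))"

definition vconv :: "('a::field \<Rightarrow> real) \<Rightarrow> (nat \<Rightarrow> 'a) \<Rightarrow> 'a \<Rightarrow> bool" where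
  "vconv v s L \<longleftrightarrow> (\<lambda>n. v (s n - L)) \<longlonglongrightarrow> 0"

definition vcomplete :: "('a::field \<Rightarrow> real) \<Rightarrow> bool" where
  "vcomplete v \<longleftrightarrow> (\<forall>s. (\<forall>e>0. \<exists>N. \<forall>m\<ge>N. \<forall>n\<ge>N. v (s m - s n) < e) \<longrightarrow> (\<exists>L. vconv v s L))"

definition vlim :: "('a::field \<Rightarrow> real) \<Rightarrow> (nat \<Rightarrow> 'a) \<Rightarrow> 'a" where
  "vlim v s = (THE L. vconv v s L)"

definition vsuminf :: "('a::field \<Rightarrow> real) \<Rightarrow> (nat \<Rightarrow> 'a) \<Rightarrow> 'a" where
  "vsuminf v f = vlim v (\<lambda>N. \<Sum>j<N. f j)"

definition Fq :: "nat \<Rightarrow> 'a::field set" where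
  "Fq q = {x. x ^ q = x}"

definition Fq_poly :: "nat \<Rightarrow> 'a::field poly set" where
  "Fq_poly q = {P. \<forall>i. coeff P i \<in> Fq q}"

definition A_elems :: "nat \<Rightarrow> 'a::field \<Rightarrow> 'a set" where
  "A_elems q \<theta> = (\<lambda>P. poly P \<theta>) ` Fq_poly q"

definition algebraic_over :: "'a::field set \<Rightarrow> 'a \<Rightarrow> bool" where
  "algebraic_over S y \<longleftrightarrow> (\<exists>P. P \<noteq> 0 \<and> (\<forall>i. coeff P i \<in> S) \<and> poly P y = 0)"

definition Dq :: "nat \<Rightarrow> 'a::field \<Rightarrow> nat \<Rightarrow> 'a" where
  "Dq q \<theta> j = (\<Prod>P\<in>{P \<in> Fq_poly q. degree P = j \<and> lead_coeff P = 1}. poly P \<theta>)"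

definition A_deg :: "nat \<Rightarrow> nat \<Rightarrow> 'a::field poly set" where
  "A_deg q d = {P \<in> Fq_poly q. P = 0 \<or> degree P < d}"

definition Ecar :: "nat \<Rightarrow> 'a::field \<Rightarrow> nat \<Rightarrow> 'a \<Rightarrow> 'a" where
  "Ecar q \<theta> d z = inverse (Dq q \<theta> d) * (\<Prod>P\<in>A_deg q d. z - poly P \<theta>)"

definition eC :: "('a::field \<Rightarrow> real) \<Rightarrow> nat \<Rightarrow> 'a \<Rightarrow> 'a \<Rightarrow> 'a" where
  "eC v q \<theta> z = vsuminf v (\<lambda>j. z ^ (q ^ j) / Dq q \<theta> j)"

definition pitilde :: "('a::field \<Rightarrow> real) \<Rightarrow> nat \<Rightarrow> 'a \<Rightarrow> 'a \<Rightarrow> 'a" where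
  "pitilde v q \<theta> \<iota> = vlim v (\<lambda>N. \<iota> * \<theta> * (\<Prod>j\<in>{1..N}. inverse (1 - \<theta> / \<theta> ^ (q ^ j))))"

text \<open>Elements of the Tate algebra T are represented by their coefficient sequences
nat => 'a. Convergence in T is convergence for the Gauss norm (sup of v of the
coefficients).\<close>

definition tconv :: "('a::field \<Rightarrow> real) \<Rightarrow> (nat \<Rightarrow> nat \<Rightarrow> 'a) \<Rightarrow> (nat \<Rightarrow> 'a) \<Rightarrow> bool" where
  "tconv v F G \<longleftrightarrow> (\<forall>e>0. \<exists>N. \<forall>n\<ge>N. \<forall>k. v (F n k - G k) < e)"

definition tlim :: "('a::field \<Rightarrow> real) \<Rightarrow> (nat \<Rightarrow> nat \<Rightarrow> 'a) \<Rightarrow> (nat \<Rightarrow> 'a)" where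
  "tlim v F = (THE G. tconv v F G)"

definition tmult :: "(nat \<Rightarrow> 'a::field) \<Rightarrow> (nat \<Rightarrow> 'a) \<Rightarrow> (nat \<Rightarrow> 'a)" where
  "tmult f g = (\<lambda>n. \<Sum>i\<le>n. f i * g (n - i))"

definition tone :: "nat \<Rightarrow> 'a::field" where
  "tone = (\<lambda>k. if k = 0 then 1 else 0)"

fun tprod :: "(nat \<Rightarrow> nat \<Rightarrow> 'a::field) \<Rightarrow> nat \<Rightarrow> (nat \<Rightarrow> 'a)" where
  "tprod f 0 = tone"
| "tprod f (Suc n) = tmult (tprod f n) (f n)"

text \<open>(1 - t/a)^{-1} in T, i.e. the series sum_k a^{-k} t^k (for v a > 1).\<close>
definition tinv_lin :: "'a::field \<Rightarrow> (nat \<Rightarrow> 'a)" where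
  "tinv_lin a = (\<lambda>k. inverse a ^ k)"

definition omega :: "('a::field \<Rightarrow> real) \<Rightarrow> nat \<Rightarrow> 'a \<Rightarrow> 'a \<Rightarrow> (nat \<Rightarrow> 'a)" where
  "omega v q \<theta> \<iota> = tlim v (\<lambda>N k. \<iota> * tprod (\<lambda>j. tinv_lin (\<theta> ^ (q ^ j))) N k)"

definition bpoly :: "nat \<Rightarrow> 'a::field \<Rightarrow> nat \<Rightarrow> 'a poly" where
  "bpoly q \<theta> j = (\<Prod>i<j. [:- (\<theta> ^ (q ^ i)), 1:])"

definition fC :: "('a::field \<Rightarrow> real) \<Rightarrow> nat \<Rightarrow> 'a \<Rightarrow> 'a \<Rightarrow> (nat \<Rightarrow> 'a)" where
  "fC v q \<theta> w = (\<lambda>j. eC v q \<theta> (w / \<theta> ^ (j + 1)))"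

definition bEseries :: "('a::field \<Rightarrow> real) \<Rightarrow> nat \<Rightarrow> 'a \<Rightarrow> 'a \<Rightarrow> (nat \<Rightarrow> 'a)" where
  "bEseries v q \<theta> z = tlim v (\<lambda>N k. \<Sum>j<N. coeff (bpoly q \<theta> j) k * Ecar q \<theta> j z)"

end

(* Write G(z) for the series sum_j b_j(t) E_j(z) and G_N(z) for the sum over j < N. Carlitz's relation
   E_j(theta z) = theta^(q^j) E_j(z) + E_{j-1}(z) telescopes to
     G_{N+1}(theta z) = t G_N(z) + b_N(t) theta^(q^N) E_N(z).
   The partial product of omega(t) over j < N turns the last term into (iota theta)^(q^N) E_N(z),
   which is exactly the sum over i <= N of (pi_{N-i} z)^(q^i) / D_i, with pi_n the partial products of
   pitilde, and which therefore tends to e_C(pitilde z). In the limit,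
     omega(t) G(theta z) = t omega(t) G(z) + e_C(pitilde z),
   the functional equation that f_C(pitilde z; t) satisfies trivially. Comparing the coefficients of t^k,
   it determines a family of series in t indexed by z, by induction on k. *)

theory Submission
  imports Defs "HOL-Computational_Algebra.Computational_Algebra"
begin

text \<open>A new root \<open>c\<close> is not a root of the product already split off, so it must
  be a root of the cofactor.\<close>

lemma prod_linear_factors_dvd:
  fixes P :: "'a::field poly"
  assumes "finite R" "\<And>c. c \<in> R \<Longrightarrow> poly P c = 0"
  shows "(\<Prod>c\<in>R. [:- c, 1:]) dvd P"
  using assms
proof (induction R rule: finite_induct)
  case (insert c R)
  then obtain S where S: "P = (\<Prod>c\<in>R. [:- c, 1:]) * S" by auto
  have "poly (\<Prod>c\<in>R. [:- c, 1:]) c \<noteq> 0" using insert.hyps by (auto simp: poly_prod)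
  moreover have "poly P c = 0" using insert.prems by simp
  ultimately have "poly S c = 0" by (simp add: S)
  hence "[:- c, 1:] dvd S" by (simp add: poly_eq_0_iff_dvd)
  hence "[:- c, 1:] * (\<Prod>c\<in>R. [:- c, 1:]) dvd S * (\<Prod>c\<in>R. [:- c, 1:])" by (rule mult_dvd_mono) simp
  thus ?case unfolding S prod.insert[OF insert.hyps] by (simp only: mult.commute[of _ S])
qed simp

text \<open>Algebraic closedness enters through the splitting of X^q - X, completeness through
  \<open>vconv_if_steps_null\<close>.\<close>

locale carlitz =
  fixes v :: "'a::field \<Rightarrow> real" and p q :: nat and \<theta> \<iota> :: 'a
  assumes prime_p: "prime p" and q_power: "\<exists>n>0. q = p ^ n" and char_p: "of_nat p = (0::'a)"
    and nonarch: "is_nonarch_abs v" and complete: "vcomplete v"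
    and alg_closed: "\<And>P::'a poly. degree P > 0 \<Longrightarrow> \<exists>x. poly P x = 0"
    and v_theta: "v \<theta> = real q"
    and iota_power: "\<iota> ^ (q - 1) = - \<theta>"
begin

subsection \<open>Frobenius and the finite field\<close>

lemma q_ge_2: "q \<ge> 2"
proof -
  obtain n where "n > 0" "q = p ^ n" using q_power by blast
  moreover have "p \<ge> 2" using prime_p by (rule prime_ge_2_nat)
  ultimately show ?thesis
    by (metis One_nat_def Suc_leI order.trans power_increasing power_one_right prime_ge_1_nat prime_p)
qed

lemma q_pos: "q > 0" and q_gt_1: "q > 1"
  using q_ge_2 by auto

lemma CHAR_eq: "CHAR('a) = p"
proof -
  have "CHAR('a) dvd p" using char_p by (simp add: of_nat_eq_0_iff_char_dvd)
  moreover have "CHAR('a) \<noteq> 1" by simp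
  ultimately show ?thesis using prime_p by (metis prime_nat_iff)
qed

lemma frob_add: "(x + y :: 'a) ^ q = x ^ q + y ^ q"
proof -
  obtain n where "q = p ^ n" using q_power by blast
  thus ?thesis by (intro freshmans_dream'[of q n]) (simp_all add: CHAR_eq prime_p)
qed

lemma frob_diff: "(x - y :: 'a) ^ q = x ^ q - y ^ q"
  using frob_add[of "x - y" y] by simp

lemma frob_minus: "(- x :: 'a) ^ q = - (x ^ q)"
  using frob_diff[of 0 x] q_pos by simp

lemma frob_sum: "(\<Sum>i\<in>I. f i :: 'a) ^ q = (\<Sum>i\<in>I. f i ^ q)"
  by (induction I rule: infinite_finite_induct) (use q_pos in \<open>simp_all add: frob_add\<close>)

lemma frob_iter_Suc: "(x ^ (q ^ n)) ^ q = (x::'a) ^ (q ^ Suc n)"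
  by (simp add: power_mult[symmetric] mult.commute)

lemma frob_iter_diff: "(x - y :: 'a) ^ (q ^ n) = x ^ (q ^ n) - y ^ (q ^ n)"
proof (induction n)
  case (Suc n)
  show ?case unfolding frob_iter_Suc[symmetric] Suc frob_diff ..
qed simp

lemma power_q: "x ^ q = x ^ (q - 1) * (x::'a)"
  using q_pos by (metis power_minus_mult)

lemma of_nat_q: "of_nat q = (0::'a)"
proof -
  obtain n where "n > 0" "q = p ^ n" using q_power by blast
  thus ?thesis using char_p by simp
qed

text \<open>X^q - X is monic with root set \<open>Fq q\<close>, splits over the algebraically closed
  field and has no repeated root. Comparing degrees then shows that \<open>Fq q\<close> really has q
  elements.\<close>

lemma frobenius_poly_eq_prod: "monom 1 q - [:0, 1:] = (\<Prod>c\<in>Fq q. [:- c, 1 :: 'a:])"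
proof -
  define P where "P = monom 1 q - [:0, 1 :: 'a:]"
  have deg: "degree P = q" "lead_coeff P = 1"
  proof -
    have "degree [:0, 1 :: 'a:] < degree (monom (1::'a) q)" using q_ge_2 by (simp add: degree_monom_eq)
    hence "degree P = degree (monom (1::'a) q)"
      unfolding P_def diff_conv_add_uminus by (intro degree_add_eq_left) simp
    thus "degree P = q" by (simp add: degree_monom_eq)
    thus "lead_coeff P = 1" using q_ge_2 by (simp add: P_def coeff_pCons split: nat.split)
  qed
  have P0: "P \<noteq> 0" using deg(2) by auto
  have roots: "{x. poly P x = 0} = Fq q" by (auto simp: P_def Fq_def poly_monom)
  have fin: "finite (Fq q :: 'a set)" using poly_roots_finite[OF P0] roots by simp
  define Q where "Q = (\<Prod>c\<in>Fq q. [:- c, 1 :: 'a:])"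
  have "Q dvd P" unfolding Q_def using fin roots by (intro prod_linear_factors_dvd) auto
  then obtain S where S: "P = Q * S" ..
  \<comment> \<open>A root of the cofactor would be a double root of \<open>P\<close>, but the
    derivative of \<open>P\<close> is the constant -1 because q = 0 in the field.\<close>
  have "degree S = 0"
  proof (rule ccontr)
    assume "degree S \<noteq> 0"
    then obtain x where x: "poly S x = 0" using alg_closed[of S] by blast
    hence "x \<in> Fq q" using roots S by auto
    hence "poly Q x = 0" using fin by (auto simp: Q_def poly_prod)
    hence "poly (pderiv P) x = 0" using x by (simp add: S pderiv_mult)
    moreover have "poly (pderiv P) x = - 1"
      by (simp add: P_def pderiv_diff pderiv_monom pderiv_pCons of_nat_q)
    ultimately show False by simp
  qed
  then obtain s where s: "S = [:s:]" by (metis degree_eq_zeroE)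
  have "lead_coeff Q = 1" unfolding Q_def by (subst lead_coeff_prod) simp
  moreover have "lead_coeff P = lead_coeff Q * s" unfolding S lead_coeff_mult by (simp add: s)
  ultimately have "s = 1" using deg(2) by simp
  thus ?thesis using S s by (simp add: P_def Q_def)
qed

lemma card_Fq: "card (Fq q :: 'a set) = q"
proof -
  have "card (Fq q :: 'a set) = degree (\<Prod>c\<in>Fq q. [:- c, 1 :: 'a:])"
    by (subst degree_prod_eq_sum_degree) auto
  also have "\<dots> = degree (monom 1 q - [:0, 1 :: 'a:])" by (simp only: frobenius_poly_eq_prod)
  also have "\<dots> = degree (monom (1::'a) q)"
    unfolding diff_conv_add_uminus using q_ge_2 by (intro degree_add_eq_left) (simp add: degree_monom_eq)
  finally show ?thesis by (simp add: degree_monom_eq)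
qed

text \<open>Homogeneous form of the factorisation of X^q - X: put X = x / y and multiply by y^q. It
  turns products over a leading coefficient into two-term recursions.\<close>

lemma prod_Fq_linear: "(\<Prod>c\<in>Fq q. x - c * y) = x ^ q - y ^ (q - 1) * (x::'a)"
proof (cases "y = 0")
  case True
  thus ?thesis using q_ge_2 by (simp add: card_Fq)
next
  case False
  have *: "(\<Prod>c\<in>Fq q. u - c) = u ^ q - u" for u :: 'a
    using arg_cong[OF frobenius_poly_eq_prod, of "\<lambda>P. poly P u"] by (simp add: poly_prod poly_monom)
  have "(\<Prod>c\<in>Fq q. x - c * y) = (\<Prod>c\<in>Fq q. y * (x / y - c))"
    using False by (intro prod.cong) (simp_all add: field_simps)
  also have "\<dots> = y ^ q * ((x / y) ^ q - x / y)" by (simp add: prod.distrib card_Fq *)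
  also have "\<dots> = x ^ q - y ^ q * (x / y)"
    using False by (simp add: right_diff_distrib power_divide)
  also have "y ^ q * (x / y) = y ^ (q - 1) * x" using False unfolding power_q[of y] by simp
  finally show ?thesis .
qed

subsection \<open>The absolute value\<close>

lemma v_nonneg: "v x \<ge> 0" and v_eq_0: "v x = 0 \<longleftrightarrow> x = 0"
  and v_mult: "v (x * y) = v x * v y" and v_add: "v (x + y) \<le> max (v x) (v y)"
  using nonarch by (auto simp: is_nonarch_abs_def)

lemma v_zero [simp]: "v 0 = 0"
  by (simp add: v_eq_0)

lemma v_one [simp]: "v 1 = 1"
  using v_mult[of 1 1] v_eq_0[of 1] by simp

lemma v_power: "v (x ^ n) = v x ^ n"
  by (induction n) (simp_all add: v_mult)

lemma v_minus [simp]: "v (- x) = v x"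
proof -
  have "v (- 1) ^ 2 = 1" by (simp flip: v_power)
  hence "v (- 1) = 1" using v_nonneg[of "- 1"] by (simp add: power2_eq_1_iff)
  thus ?thesis using v_mult[of "- 1" x] by simp
qed

lemma v_diff: "v (x - y) \<le> max (v x) (v y)"
  using v_add[of x "- y"] by simp

lemma v_inverse: "v (inverse x) = inverse (v x)"
proof (cases "x = 0")
  case False
  hence "v x * v (inverse x) = 1" by (simp flip: v_mult)
  thus ?thesis by (simp add: inverse_unique)
qed simp

lemma v_divide: "v (x / y) = v x / v y"
  by (simp add: divide_inverse v_mult v_inverse)

lemma v_prod: "v (\<Prod>i\<in>I. f i) = (\<Prod>i\<in>I. v (f i))"
  by (induction I rule: infinite_finite_induct) (simp_all add: v_mult)

text \<open>If \<open>v (x - y)\<close> were smaller than \<open>v x\<close>, then x = (x - y) + y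
  would violate the ultrametric inequality.\<close>

lemma v_diff_dominant: "v (x - y) = v x" if "v y < v x"
  using v_diff[of x y] v_add[of "x - y" y] that by simp

lemma v_sum_le: "v (\<Sum>i\<in>I. f i) \<le> C" if "C \<ge> 0" "\<And>i. i \<in> I \<Longrightarrow> v (f i) \<le> C"
  using that(2)
proof (induction I rule: infinite_finite_induct)
  case (insert i I)
  thus ?case using v_add[of "f i" "sum f I"] by (fastforce intro: order.trans)
qed (simp_all add: that(1))

lemma v_theta_gt_1: "v \<theta> > 1"
  using v_theta q_gt_1 by simp

lemma theta_nonzero [simp]: "\<theta> \<noteq> 0"
  using v_theta_gt_1 by auto

lemma v_theta_power_less: "v (\<theta> ^ m) < v (\<theta> ^ n)" if "m < n"
  using v_theta_gt_1 that by (simp add: v_power)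

lemma power_q_less: "q ^ m < q ^ n" if "m < n"
  using q_gt_1 that by simp

text \<open>This difference is the Carlitz bracket [n], the factor that governs the recursion of the
  D_n.\<close>

lemma v_theta_bracket: "v (\<theta> ^ (q ^ n) - \<theta>) = v \<theta> ^ (q ^ n)" if "n > 0"
  using v_diff_dominant[of \<theta> "\<theta> ^ (q ^ n)"] v_theta_power_less[of 1 "q ^ n"] power_q_less[of 0 n] that
  by (simp add: v_power)

lemma theta_bracket_nonzero: "\<theta> ^ (q ^ n) - \<theta> \<noteq> 0" if "n > 0"
  using v_theta_bracket[OF that] v_theta_gt_1 by auto

lemma iota_nonzero [simp]: "\<iota> \<noteq> 0"
  using iota_power q_gt_1 by (auto simp: zero_power)

lemma iota_power_q: "\<iota> ^ q = - \<theta> * \<iota>"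
  unfolding power_q[of \<iota>] iota_power ..

subsection \<open>Carlitz polynomials\<close>

text \<open>Carlitz's unnormalised e_d. It is studied before \<open>Ecar\<close> because the
  nonvanishing of \<open>Dq\<close> is itself derived from its recursions.\<close>

definition ecar :: "nat \<Rightarrow> 'a \<Rightarrow> 'a" where
  "ecar d z = (\<Prod>P\<in>A_deg q d. z - poly P \<theta>)"

lemma A_deg_0: "A_deg q 0 = {0 :: 'a poly}"
  using q_pos by (auto simp: A_deg_def Fq_poly_def Fq_def)

lemma coeff_A_deg: "P \<in> A_deg q d \<Longrightarrow> d \<le> i \<Longrightarrow> coeff P i = (0::'a)"
  by (auto simp: A_deg_def coeff_eq_0)

lemma coeff_A_deg_Fq: "P \<in> A_deg q d \<Longrightarrow> coeff P i \<in> (Fq q :: 'a set)"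
  by (auto simp: A_deg_def Fq_poly_def)

lemma A_deg_I:
  fixes P :: "'a poly"
  assumes "\<And>i. coeff P i \<in> Fq q" "\<And>i. i \<ge> d \<Longrightarrow> coeff P i = 0"
  shows "P \<in> A_deg q d"
proof -
  have "P = 0 \<or> degree P < d" using assms(2)[of "degree P"] by (cases "P = 0") force+
  thus ?thesis using assms(1) by (auto simp: A_deg_def Fq_poly_def)
qed

lemma zero_in_Fq [simp]: "0 \<in> (Fq q :: 'a set)" and one_in_Fq [simp]: "1 \<in> (Fq q :: 'a set)"
  and add_in_Fq: "x \<in> Fq q \<Longrightarrow> y \<in> Fq q \<Longrightarrow> x + y \<in> (Fq q :: 'a set)"
  and diff_in_Fq: "x \<in> Fq q \<Longrightarrow> y \<in> Fq q \<Longrightarrow> x - y \<in> (Fq q :: 'a set)"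
  using q_pos by (auto simp: Fq_def frob_add frob_diff)

text \<open>Splits off the coefficient of degree d, so that a product over
  \<open>A_deg q (Suc d)\<close> becomes an iterated one.\<close>

lemma bij_betw_A_deg_Suc:
  "bij_betw (\<lambda>(c, P). P + monom c d) (Fq q \<times> A_deg q d) (A_deg q (Suc d) :: 'a poly set)"
proof (rule bij_betw_byWitness[where f' = "\<lambda>P. (coeff P d, P - monom (coeff P d) d)"])
  show "(\<lambda>(c, P). P + monom c d) ` (Fq q \<times> A_deg q d) \<subseteq> (A_deg q (Suc d) :: 'a poly set)"
  proof clarify
    fix c :: 'a and P :: "'a poly" assume c: "c \<in> Fq q" and P: "P \<in> A_deg q d"
    show "P + monom c d \<in> A_deg q (Suc d)"
    proof (rule A_deg_I)
      show "coeff (P + monom c d) i \<in> Fq q" for i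
        using c coeff_A_deg_Fq[OF P] unfolding coeff_add coeff_monom by (intro add_in_Fq) auto
    qed (use coeff_A_deg[OF P] in auto)
  qed
  show "(\<lambda>P. (coeff P d, P - monom (coeff P d) d)) ` A_deg q (Suc d) \<subseteq> (Fq q \<times> A_deg q d :: ('a \<times> 'a poly) set)"
  proof clarify
    fix P :: "'a poly" assume P: "P \<in> A_deg q (Suc d)"
    have "P - monom (coeff P d) d \<in> A_deg q d"
    proof (rule A_deg_I)
      show "coeff (P - monom (coeff P d) d) i \<in> Fq q" for i
        using coeff_A_deg_Fq[OF P] unfolding coeff_diff coeff_monom by (intro diff_in_Fq) auto
      show "coeff (P - monom (coeff P d) d) i = 0" if "i \<ge> d" for i
        using that coeff_A_deg[OF P, of i] by (cases "i = d") auto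
    qed
    thus "coeff P d \<in> Fq q \<and> P - monom (coeff P d) d \<in> A_deg q d"
      using coeff_A_deg_Fq[OF P] by blast
  qed
  show "\<forall>x\<in>Fq q \<times> A_deg q d. (\<lambda>P. (coeff P d, P - monom (coeff P d) d)) ((\<lambda>(c, P). P + monom c d) x) = (x :: 'a \<times> 'a poly)"
  proof clarify
    fix c :: 'a and P :: "'a poly" assume "P \<in> A_deg q d"
    hence "coeff P d = 0" by (rule coeff_A_deg) simp
    thus "coeff (P + monom c d) d = c \<and> P + monom c d - monom (coeff (P + monom c d) d) d = P" by simp
  qed
qed simp

text \<open>The involution taking P to X^d - P exchanges the polynomials of degree < d with the
  monic ones of degree d.\<close>

lemma Dq_eq: "Dq q \<theta> d = ecar d (\<theta> ^ d)"
proof -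
  have "bij_betw (\<lambda>P. monom 1 d - P) (A_deg q d) {P \<in> Fq_poly q. degree P = d \<and> lead_coeff P = (1::'a)}"
  proof (rule bij_betw_byWitness[where f' = "\<lambda>P. monom 1 d - P"])
    show "(\<lambda>P. monom 1 d - P) ` A_deg q d \<subseteq> {P \<in> Fq_poly q. degree P = d \<and> lead_coeff P = (1::'a)}"
    proof safe
      fix P :: "'a poly" assume P: "P \<in> A_deg q d"
      have "coeff (monom 1 d - P) i \<in> Fq q" for i
        using coeff_A_deg_Fq[OF P] unfolding coeff_diff coeff_monom by (intro diff_in_Fq) auto
      thus "monom 1 d - P \<in> Fq_poly q" by (simp add: Fq_poly_def)
      have 1: "coeff (monom 1 d - P) d = 1" using coeff_A_deg[OF P, of d] by simp
      moreover have "degree (monom 1 d - P) \<le> d"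
        by (intro degree_le) (auto simp: coeff_A_deg[OF P])
      ultimately show "degree (monom 1 d - P) = d"
        using le_degree[of "monom 1 d - P" d] by simp
      thus "lead_coeff (monom 1 d - P) = 1" using 1 by simp
    qed
    show "(\<lambda>P. monom 1 d - P) ` {P \<in> Fq_poly q. degree P = d \<and> lead_coeff P = (1::'a)} \<subseteq> A_deg q d"
    proof safe
      fix P :: "'a poly" assume P: "P \<in> Fq_poly q" "d = degree P" "lead_coeff P = 1"
      show "monom 1 (degree P) - P \<in> A_deg q (degree P)"
      proof (rule A_deg_I)
        show "coeff (monom 1 (degree P) - P) i \<in> Fq q" for i
          using P(1) unfolding coeff_diff coeff_monom by (intro diff_in_Fq) (auto simp: Fq_poly_def)
        show "coeff (monom 1 (degree P) - P) i = 0" if "i \<ge> degree P" for i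
          using that P(3) by (cases "i = degree P") (simp_all add: coeff_eq_0)
      qed
    qed
  qed auto
  from prod.reindex_bij_betw[OF this, of "\<lambda>P. poly P \<theta>"]
  show ?thesis by (simp add: Dq_def ecar_def poly_monom)
qed

lemma ecar_0: "ecar 0 z = z"
  by (simp add: ecar_def A_deg_0)

lemma Dq_0: "Dq q \<theta> 0 = 1"
  by (simp add: Dq_eq ecar_0)

lemma ecar_Suc_prod: "ecar (Suc d) z = (\<Prod>c\<in>Fq q. ecar d (z - c * \<theta> ^ d))"
proof -
  have "ecar (Suc d) z = (\<Prod>(c, P)\<in>Fq q \<times> A_deg q d. z - poly (P + monom c d) \<theta>)"
    unfolding ecar_def
    by (subst prod.reindex_bij_betw[OF bij_betw_A_deg_Suc, symmetric]) (simp add: case_prod_unfold)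
  also have "\<dots> = (\<Prod>c\<in>Fq q. ecar d (z - c * \<theta> ^ d))"
    by (simp add: ecar_def prod.cartesian_product[symmetric] poly_monom algebra_simps)
  finally show ?thesis .
qed

text \<open>The three claims feed each other. The recursion at d makes e_{d+1} additive and
  Fq-linear; linearity turns the factors of e_{d+2} into e_{d+1}(z) - c D_{d+1}, and
  \<open>prod_Fq_linear\<close> yields the next recursion.\<close>

lemma ecar_linear_Suc:
  "(\<forall>x y. ecar d (x - y) = ecar d x - ecar d y) \<and> (\<forall>c\<in>Fq q. \<forall>x. ecar d (c * x) = c * ecar d x) \<and>
   (\<forall>z. ecar (Suc d) z = ecar d z ^ q - Dq q \<theta> d ^ (q - 1) * ecar d z)"
proof (induction d)
  case 0
  have "ecar (Suc 0) z = z ^ q - z" for z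
    using prod_Fq_linear[of z 1] by (simp add: ecar_Suc_prod ecar_0)
  thus ?case by (simp add: ecar_0 Dq_0)
next
  case (Suc d)
  have rec: "ecar (Suc d) z = ecar d z ^ q - Dq q \<theta> d ^ (q - 1) * ecar d z" for z
    using Suc by blast
  have "ecar d (x - y) = ecar d x - ecar d y" for x y using Suc by blast
  hence diff: "ecar (Suc d) (x - y) = ecar (Suc d) x - ecar (Suc d) y" for x y
    by (simp add: rec frob_diff right_diff_distrib)
  have scale: "ecar (Suc d) (c * x) = c * ecar (Suc d) x" if "c \<in> Fq q" for c x
  proof -
    have "ecar d (c * x) = c * ecar d x" using Suc that by blast
    moreover have "c ^ q = c" using that by (simp add: Fq_def)
    ultimately show ?thesis unfolding rec by (simp add: power_mult_distrib right_diff_distrib)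
  qed
  have "ecar (Suc (Suc d)) z
      = ecar (Suc d) z ^ q - Dq q \<theta> (Suc d) ^ (q - 1) * ecar (Suc d) z" for z
  proof -
    have "ecar (Suc (Suc d)) z = (\<Prod>c\<in>Fq q. ecar (Suc d) z - c * Dq q \<theta> (Suc d))"
      unfolding ecar_Suc_prod[of "Suc d"] diff Dq_eq by (intro prod.cong refl) (simp only: scale)
    thus ?thesis by (simp only: prod_Fq_linear)
  qed
  thus ?case using diff scale by (intro conjI allI ballI)
qed

lemma ecar_Suc: "ecar (Suc d) z = ecar d z ^ q - Dq q \<theta> d ^ (q - 1) * ecar d z"
  using ecar_linear_Suc by blast

lemma ecar_Suc_theta_pow: "ecar (Suc d) (\<theta> ^ d) = 0"
  unfolding ecar_Suc Dq_eq[symmetric] power_q[of "Dq q \<theta> d"] by simp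

text \<open>Isolated because the induction for \<open>ecar_theta_mult\<close> needs this recursion at each step,
  before its unconditional form \<open>Dq_Suc\<close> is available.\<close>
lemma Dq_Suc_if:
  assumes "ecar (Suc d) (\<theta> * \<theta> ^ d)
    = \<theta> * ecar (Suc d) (\<theta> ^ d) + (\<theta> ^ (q ^ Suc d) - \<theta>) * ecar d (\<theta> ^ d) ^ q"
  shows "Dq q \<theta> (Suc d) = (\<theta> ^ (q ^ Suc d) - \<theta>) * Dq q \<theta> d ^ q"
  using assms by (simp add: Dq_eq ecar_Suc_theta_pow)

text \<open>Induction on d: expand e_{d+2}(\<theta> z) by \<open>ecar_Suc\<close>, insert the
  hypothesis for e_{d+1}(\<theta> z), and recognise \<open>ecar_Suc\<close> again in the
  result.\<close>

lemma ecar_theta_mult: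
  "ecar (Suc d) (\<theta> * z) = \<theta> * ecar (Suc d) z + (\<theta> ^ (q ^ Suc d) - \<theta>) * ecar d z ^ q"
proof (induction d arbitrary: z)
  case 0
  show ?case by (simp add: ecar_Suc ecar_0 Dq_0 power_mult_distrib algebra_simps)
next
  case (Suc d)
  define B where "B = \<theta> ^ (q ^ Suc d) - \<theta>"
  define D where "D = Dq q \<theta> d"
  define D' where "D' = Dq q \<theta> (Suc d)"
  define x where "x = ecar d z"
  define y where "y = ecar (Suc d) z"
  \<comment> \<open>This is the induction hypothesis at z = \<theta>^d, where e_{d+1}
    vanishes.\<close>
  have D': "D' = B * D ^ q"
    using Dq_Suc_if[OF Suc] by (simp add: D_def D'_def B_def)
  have y: "y = x ^ q - D ^ (q - 1) * x" by (simp add: y_def x_def D_def ecar_Suc)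
  have Bq: "B ^ q = \<theta> ^ (q ^ Suc (Suc d)) - \<theta> ^ q"
    by (simp add: B_def frob_diff frob_iter_Suc del: power_Suc)
  have yq: "y ^ q = (x ^ q) ^ q - (D ^ q) ^ (q - 1) * x ^ q"
    by (simp add: y frob_diff power_mult_distrib power_mult[symmetric] mult.commute)
  have "ecar (Suc (Suc d)) (\<theta> * z) = (\<theta> * y + B * x ^ q) ^ q - D' ^ (q - 1) * (\<theta> * y + B * x ^ q)"
    using Suc[of z] by (subst ecar_Suc) (simp add: D'_def y_def x_def B_def)
  also have "\<dots> = \<theta> ^ q * y ^ q + B ^ q * (x ^ q) ^ q - D' ^ (q - 1) * \<theta> * y
      - B ^ (q - 1) * B * (D ^ q) ^ (q - 1) * x ^ q"
    by (simp add: frob_add D' power_mult_distrib algebra_simps)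
  \<comment> \<open>By \<open>yq\<close> the two terms carrying B^q combine to B^q y^q; then
    \<theta> y^q is added and subtracted.\<close>
  also have "\<dots> = \<theta> * (y ^ q - D' ^ (q - 1) * y) + (\<theta> ^ q - \<theta> + B ^ q) * y ^ q"
    unfolding yq power_q[of B] by (simp only: algebra_simps)
  also have "\<theta> ^ q - \<theta> + B ^ q = \<theta> ^ (q ^ Suc (Suc d)) - \<theta>" by (simp add: Bq)
  also have "y ^ q - D' ^ (q - 1) * y = ecar (Suc (Suc d)) z"
    by (simp add: ecar_Suc[of "Suc d"] y_def D'_def)
  finally show ?case by (simp add: y_def)
qed

lemma Dq_Suc: "Dq q \<theta> (Suc d) = (\<theta> ^ (q ^ Suc d) - \<theta>) * Dq q \<theta> d ^ q"
  by (rule Dq_Suc_if[OF ecar_theta_mult])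

lemma Dq_nonzero [simp]: "Dq q \<theta> d \<noteq> 0"
proof (induction d)
  case (Suc d)
  thus ?case using theta_bracket_nonzero[of "Suc d"] unfolding Dq_Suc by simp
qed (simp add: Dq_0)

lemma Ecar_eq: "Ecar q \<theta> d z = ecar d z / Dq q \<theta> d"
  by (simp add: Ecar_def ecar_def divide_inverse mult.commute)

lemma Ecar_0: "Ecar q \<theta> 0 z = z"
  by (simp add: Ecar_eq ecar_0 Dq_0)

text \<open>\<open>ecar_Suc\<close> divided by D_d^q; by \<open>Dq_Suc\<close> the bracket is
  exactly what separates D_d^q from D_{d+1}.\<close>

lemma Ecar_Suc: "(\<theta> ^ (q ^ Suc d) - \<theta>) * Ecar q \<theta> (Suc d) z = Ecar q \<theta> d z ^ q - Ecar q \<theta> d z"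
proof -
  define B D x where "B = \<theta> ^ (q ^ Suc d) - \<theta>" and "D = Dq q \<theta> d" and "x = ecar d z"
  have nz: "B \<noteq> 0" "D \<noteq> 0" using theta_bracket_nonzero by (simp_all add: B_def D_def del: power_Suc)
  have "B * ((x ^ q - D ^ (q - 1) * x) / (B * D ^ q)) = (x ^ q - D ^ (q - 1) * x) / D ^ q"
    using nz by simp
  also have "\<dots> = (x / D) ^ q - D ^ (q - 1) * x / D ^ q"
    by (simp add: diff_divide_distrib power_divide)
  also have "D ^ (q - 1) * x / D ^ q = x / D" unfolding power_q[of D] using nz by simp
  finally show ?thesis unfolding Ecar_eq Dq_Suc ecar_Suc B_def D_def x_def .
qed

text \<open>Normalising \<open>ecar_theta_mult\<close> leaves the nonlinear term E_d(z)^q, which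
  \<open>Ecar_Suc\<close> replaces by linear ones. This is the relation that telescopes.\<close>

lemma Ecar_theta_mult:
  "Ecar q \<theta> (Suc d) (\<theta> * z) = \<theta> ^ (q ^ Suc d) * Ecar q \<theta> (Suc d) z + Ecar q \<theta> d z"
proof -
  have "Ecar q \<theta> (Suc d) (\<theta> * z) = \<theta> * Ecar q \<theta> (Suc d) z + Ecar q \<theta> d z ^ q"
    using theta_bracket_nonzero[of "Suc d"]
    by (simp add: Ecar_eq ecar_theta_mult Dq_Suc power_divide add_divide_distrib del: power_Suc)
  also have "Ecar q \<theta> d z ^ q = (\<theta> ^ (q ^ Suc d) - \<theta>) * Ecar q \<theta> (Suc d) z + Ecar q \<theta> d z"
    by (simp add: Ecar_Suc del: power_Suc)
  finally show ?thesis by (simp add: algebra_simps del: power_Suc)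
qed

subsection \<open>Non-archimedean limits\<close>

lemma vconv_iff: "vconv v s L \<longleftrightarrow> (\<forall>e>0. \<exists>N. \<forall>n\<ge>N. v (s n - L) < e)"
  by (simp add: vconv_def LIMSEQ_iff v_nonneg)

lemma vconv_bound: "vconv v s L" if "c \<longlonglongrightarrow> 0" "\<And>n. v (s n - L) \<le> c n"
  unfolding vconv_def using that v_nonneg by (intro tendsto_sandwich[OF _ _ tendsto_const that(1)]) auto

lemma vconv_unique: "L = L'" if "vconv v s L" "vconv v s L'"
proof -
  have "(\<lambda>n. v (s n - L) + v (s n - L')) \<longlonglongrightarrow> 0 + 0"
    using that unfolding vconv_def by (rule tendsto_add)
  moreover have "v (L - L') \<le> v (s n - L) + v (s n - L')" for n
    using v_diff[of "s n - L'" "s n - L"] v_nonneg[of "s n - L"] v_nonneg[of "s n - L'"] by simp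
  ultimately have "v (L - L') \<le> 0"
    by (intro tendsto_lowerbound[where F = sequentially]) auto
  thus ?thesis using v_nonneg[of "L - L'"] v_eq_0[of "L - L'"] by simp
qed

lemma vlim_eq: "vlim v s = L" if "vconv v s L"
  unfolding vlim_def using that vconv_unique by blast

lemma vconv_const: "vconv v (\<lambda>_. c) c"
  by (simp add: vconv_def)

lemma vconv_add: "vconv v (\<lambda>n. s n + t n) (L + M)" if "vconv v s L" "vconv v t M"
proof (rule vconv_bound)
  show "(\<lambda>n. v (s n - L) + v (t n - M)) \<longlonglongrightarrow> 0"
    using tendsto_add[OF that[unfolded vconv_def]] by simp
  show "v (s n + t n - (L + M)) \<le> v (s n - L) + v (t n - M)" for n
    using v_add[of "s n - L" "t n - M"] v_nonneg[of "s n - L"] v_nonneg[of "t n - M"]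
    by (simp add: algebra_simps)
qed

lemma vconv_sum: "vconv v (\<lambda>n. \<Sum>i\<in>I. s i n) (\<Sum>i\<in>I. L i)" if "\<And>i. i \<in> I \<Longrightarrow> vconv v (s i) (L i)"
  using that by (induction I rule: infinite_finite_induct) (auto intro: vconv_const vconv_add)

lemma vconv_norm_bounded:
  assumes "vconv v s L"
  obtains B where "B > 0" "\<And>n. v (s n) \<le> B"
proof -
  have "Bseq (\<lambda>n. v (s n - L))"
    using assms unfolding vconv_def by (intro convergent_imp_Bseq convergentI)
  then obtain K where K: "K > 0" "\<And>n. v (s n - L) \<le> K"
    by (auto simp: Bseq_def v_nonneg)
  have "v (s n) \<le> K + v L" for n
    using v_add[of "s n - L" L] K(2)[of n] K(1) v_nonneg[of L] by (auto simp: max_def split: if_splits)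
  thus ?thesis using K(1) v_nonneg[of L] by (intro that[of "K + v L"]) auto
qed

lemma vconv_mult: "vconv v (\<lambda>n. s n * t n) (L * M)" if "vconv v s L" "vconv v t M"
proof -
  from that(1) obtain B where B: "B > 0" "\<And>n. v (s n) \<le> B" by (rule vconv_norm_bounded) auto
  show ?thesis
  proof (rule vconv_bound)
    show "(\<lambda>n. B * v (t n - M) + v (s n - L) * v M) \<longlonglongrightarrow> 0"
      using tendsto_add[OF tendsto_mult_left[OF that(2)[unfolded vconv_def], of B]
        tendsto_mult_right[OF that(1)[unfolded vconv_def], of "v M"]] by simp
    show "v (s n * t n - L * M) \<le> B * v (t n - M) + v (s n - L) * v M" for n
    proof -
      have "v (s n * t n - L * M) = v (s n * (t n - M) + (s n - L) * M)" by (simp add: algebra_simps)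
      also have "\<dots> \<le> v (s n) * v (t n - M) + v (s n - L) * v M"
        using v_add[of "s n * (t n - M)" "(s n - L) * M"] v_nonneg[of "s n * (t n - M)"]
          v_nonneg[of "(s n - L) * M"] by (simp add: v_mult)
      also have "v (s n) * v (t n - M) \<le> B * v (t n - M)"
        using B(2) v_nonneg by (rule mult_right_mono)
      finally show ?thesis by simp
    qed
  qed
qed

lemma vconv_Suc: "vconv v s L \<Longrightarrow> vconv v (\<lambda>n. s (Suc n)) L"
  unfolding vconv_def by (rule LIMSEQ_Suc)

text \<open>A telescoping sum is bounded by its largest step, so null steps alone give a Cauchy
  sequence.\<close>

lemma v_telescope_less:
  assumes "e > 0" "\<And>n. n \<ge> N \<Longrightarrow> v (s (Suc n) - s n) < e" "m \<ge> N" "n \<ge> N"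
  shows "v (s m - s n) < e"
proof -
  have N: "v (s m - s N) < e" if "m \<ge> N" for m
    using that
  proof (induction m rule: dec_induct)
    case (step m)
    have "v (s (Suc m) - s N) \<le> max (v (s (Suc m) - s m)) (v (s m - s N))"
      using v_add[of "s (Suc m) - s m" "s m - s N"] by simp
    thus ?case using step assms(2)[of m] by simp
  qed (simp add: assms(1))
  have "v (s m - s n) \<le> max (v (s m - s N)) (v (s n - s N))"
    using v_diff[of "s m - s N" "s n - s N"] by simp
  thus ?thesis using N[OF assms(3)] N[OF assms(4)] by simp
qed

lemma vconv_if_steps_null:
  assumes "(\<lambda>n. v (s (Suc n) - s n)) \<longlonglongrightarrow> 0"
  shows "\<exists>L. vconv v s L"
proof -
  have "\<exists>N. \<forall>m\<ge>N. \<forall>n\<ge>N. v (s m - s n) < e" if "e > 0" for e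
  proof -
    obtain N where "\<And>n. n \<ge> N \<Longrightarrow> v (s (Suc n) - s n) < e"
      using assms \<open>e > 0\<close> by (force simp: LIMSEQ_iff v_nonneg)
    thus ?thesis using v_telescope_less[OF \<open>e > 0\<close>] by blast
  qed
  thus ?thesis using complete unfolding vcomplete_def by blast
qed

lemma vsuminf_converges:
  assumes "(\<lambda>n. v (f n)) \<longlonglongrightarrow> 0"
  shows "vconv v (\<lambda>N. \<Sum>j<N. f j) (vsuminf v f)"
proof -
  have "\<exists>L. vconv v (\<lambda>N. \<Sum>j<N. f j) L" using assms by (intro vconv_if_steps_null) simp
  thus ?thesis unfolding vsuminf_def by (metis vlim_eq)
qed

lemma tconv_imp_vconv: "tconv v F G \<Longrightarrow> vconv v (\<lambda>n. F n k) (G k)"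
  unfolding tconv_def vconv_iff by meson

lemma tlim_eq: "tlim v F = G" if "tconv v F G"
  unfolding tlim_def
proof (rule the_equality)
  show "tconv v F G" by (rule that)
next
  fix H assume "tconv v F H"
  thus "H = G" using that by (intro ext vconv_unique[OF tconv_imp_vconv tconv_imp_vconv])
qed

text \<open>Coefficientwise limits exist by completeness; since \<open>c\<close> does not depend on
  k, they are attained uniformly, that is in the Gauss norm.\<close>

lemma tlim_converges:
  assumes "c \<longlonglongrightarrow> 0" "\<And>n k. v (F (Suc n) k - F n k) \<le> c n"
  shows "tconv v F (tlim v F)"
proof -
  have "(\<lambda>n. v (F (Suc n) k - F n k)) \<longlonglongrightarrow> 0" for k
    using assms v_nonneg by (intro tendsto_sandwich[OF _ _ tendsto_const assms(1)]) auto
  hence "\<exists>L. vconv v (\<lambda>n. F n k) L" for k by (rule vconv_if_steps_null)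
  then obtain G where G: "\<And>k. vconv v (\<lambda>n. F n k) (G k)" by metis
  have "\<exists>N. \<forall>n\<ge>N. \<forall>k. v (F n k - G k) < e" if "e > 0" for e
  proof -
    obtain N where N: "\<And>n. n \<ge> N \<Longrightarrow> c n < e"
      using order_tendstoD(2)[OF assms(1) \<open>e > 0\<close>] by (auto simp: eventually_sequentially)
    have "v (F n k - G k) < e" if n: "n \<ge> N" for n k
    proof -
      obtain M where M: "\<And>m. m \<ge> M \<Longrightarrow> v (F m k - G k) < e"
        using G[of k] \<open>e > 0\<close> unfolding vconv_iff by blast
      \<comment> \<open>An intermediate index: \<open>M\<close> depends on k, but the passage from n
        to m is controlled by \<open>N\<close>, which does not.\<close>
      define m where "m = max M N"
      have "v (F n k - F m k) < e"
      proof (rule v_telescope_less[OF \<open>e > 0\<close>])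
        show "v (F (Suc n) k - F n k) < e" if "n \<ge> N" for n
          using assms(2)[of n k] N[OF that] by simp
      qed (use n in \<open>auto simp: m_def\<close>)
      moreover have "v (F m k - G k) < e" using M by (simp add: m_def)
      ultimately show ?thesis using v_add[of "F n k - F m k" "F m k - G k"] by simp
    qed
    thus ?thesis by blast
  qed
  hence "tconv v F G" unfolding tconv_def by blast
  thus ?thesis using tlim_eq by simp
qed

text \<open>Ultrametric dominated convergence: \<open>C\<close> controls all terms with large i,
  termwise convergence the finitely many others. The bound e / 2 only secures strictness, as nothing
  is added up.\<close>

lemma vconv_sum_dominated:
  assumes C: "C \<longlonglongrightarrow> 0" "\<And>N i. i \<le> N \<Longrightarrow> v (f N i) \<le> C i" and f: "\<And>i. vconv v (\<lambda>N. f N i) 0"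
  shows "vconv v (\<lambda>N. \<Sum>i\<le>N. f N i) 0"
  unfolding vconv_iff
proof safe
  fix e :: real assume e: "e > 0"
  obtain M where M: "\<And>i. i \<ge> M \<Longrightarrow> C i < e / 2"
    using order_tendstoD(2)[OF C(1), of "e / 2"] e by (auto simp: eventually_sequentially)
  have "\<forall>\<^sub>F N in sequentially. \<forall>i\<in>{..<M}. v (f N i) < e / 2"
    using f e unfolding vconv_def
    by (intro eventually_ball_finite ballI order_tendstoD(2)[where y = 0]) auto
  then obtain K where K: "\<And>N i. N \<ge> K \<Longrightarrow> i < M \<Longrightarrow> v (f N i) < e / 2"
    by (auto simp: eventually_sequentially)
  have "v ((\<Sum>i\<le>N. f N i) - 0) < e" if "N \<ge> K" for N
  proof -
    have "v (\<Sum>i\<le>N. f N i) \<le> e / 2"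
    proof (rule v_sum_le)
      fix i assume "i \<in> {..N}"
      thus "v (f N i) \<le> e / 2"
        using K[OF that, of i] M[of i] C(2)[of i N] by (cases "i < M") auto
    qed (use e in simp)
    thus ?thesis using e by simp
  qed
  thus "\<exists>N. \<forall>n\<ge>N. v ((\<Sum>i\<le>n. f n i) - 0) < e" by blast
qed

subsection \<open>The exponential as a limit of Carlitz polynomials\<close>

lemma inverse_v_theta_tendsto_0: "(\<lambda>n. c / v \<theta> ^ (q ^ n)) \<longlonglongrightarrow> 0"
proof -
  have "strict_mono (\<lambda>n. q ^ n)" using power_q_less by (auto simp: strict_mono_def)
  moreover have "(\<lambda>n. inverse (v \<theta>) ^ n) \<longlonglongrightarrow> 0"
    using v_theta_gt_1 by (intro LIMSEQ_power_zero) (simp add: inverse_less_1_iff)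
  ultimately have "((\<lambda>n. inverse (v \<theta>) ^ n) \<circ> (\<lambda>n. q ^ n)) \<longlonglongrightarrow> 0"
    by (rule LIMSEQ_subseq_LIMSEQ[rotated])
  from tendsto_mult_left[OF this, of c] show ?thesis by (simp add: o_def divide_inverse power_inverse)
qed

definition pi_part :: "nat \<Rightarrow> 'a" where
  "pi_part N = \<iota> * \<theta> * (\<Prod>j\<in>{1..N}. inverse (1 - \<theta> / \<theta> ^ (q ^ j)))"

abbreviation period :: 'a where
  "period \<equiv> pitilde v q \<theta> \<iota>"

lemma v_theta_quot_less: "v (\<theta> / \<theta> ^ (q ^ n)) < 1" if "n > 0"
  using v_theta_power_less[of 1 "q ^ n"] power_q_less[of 0 n] that v_theta_gt_1
  by (simp add: v_divide v_power divide_less_eq)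

lemma v_one_minus_theta_quot: "v (1 - \<theta> / \<theta> ^ (q ^ n)) = 1" if "n > 0"
  using v_diff_dominant[of "\<theta> / \<theta> ^ (q ^ n)" 1] v_theta_quot_less[OF that] by simp

lemma one_minus_theta_quot_nonzero: "1 - \<theta> / \<theta> ^ (q ^ n) \<noteq> 0" if "n > 0"
  using v_one_minus_theta_quot[OF that] by (metis v_zero zero_neq_one)

text \<open>Every factor of the product has absolute value 1.\<close>

lemma v_pi_part: "v (pi_part N) = v (\<iota> * \<theta>)"
proof -
  have "v (\<Prod>j\<in>{1..N}. inverse (1 - \<theta> / \<theta> ^ (q ^ j))) = (\<Prod>j\<in>{1..N}. 1)"
    unfolding v_prod by (intro prod.cong) (simp_all add: v_inverse v_one_minus_theta_quot)
  thus ?thesis by (simp add: pi_part_def v_mult)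
qed

lemma pi_part_Suc: "pi_part N = pi_part (Suc N) * (1 - \<theta> / \<theta> ^ (q ^ Suc N))"
  using one_minus_theta_quot_nonzero[of "Suc N"] unfolding pi_part_def by (simp del: power_Suc)

lemma pi_part_converges: "vconv v pi_part period"
proof -
  have "(\<lambda>n. v (pi_part (Suc n) - pi_part n)) \<longlonglongrightarrow> 0"
  proof -
    have "pi_part (Suc n) - pi_part n = pi_part (Suc n) * (\<theta> / \<theta> ^ (q ^ Suc n))" for n
      by (subst (2) pi_part_Suc) (simp add: algebra_simps del: power_Suc)
    hence "v (pi_part (Suc n) - pi_part n) = (v (\<iota> * \<theta>) * v \<theta>) / v \<theta> ^ (q ^ Suc n)" for n
      by (simp add: v_mult[of "pi_part _"] v_pi_part v_divide v_power del: power_Suc)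
    thus ?thesis using LIMSEQ_Suc[OF inverse_v_theta_tendsto_0] by (simp del: power_Suc)
  qed
  then obtain L where "vconv v pi_part L" using vconv_if_steps_null by blast
  thus ?thesis unfolding pitilde_def pi_part_def[symmetric] by (simp add: vlim_eq)
qed

lemma v_period_le: "v period \<le> v (\<iota> * \<theta>)"
proof -
  have "v (\<iota> * \<theta>) > 0" using v_nonneg[of "\<iota> * \<theta>"] v_eq_0[of "\<iota> * \<theta>"] by fastforce
  then obtain N where "v (pi_part N - period) < v (\<iota> * \<theta>)"
    using pi_part_converges unfolding vconv_iff by blast
  thus ?thesis using v_diff[of "pi_part N" "pi_part N - period"] by (simp add: v_pi_part)
qed

text \<open>Written as a q^n-th power so that R^(q^n) / v(D_n) becomes (R / v(\<theta>)^n)^(q^n),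
  with base eventually below 1/2.\<close>

lemma v_Dq: "v (Dq q \<theta> n) = (v \<theta> ^ n) ^ (q ^ n)"
proof (induction n)
  case (Suc n)
  have "v (Dq q \<theta> (Suc n)) = v \<theta> ^ (q ^ Suc n) * ((v \<theta> ^ n) ^ (q ^ n)) ^ q"
    unfolding Dq_Suc v_mult v_power Suc by (simp add: v_theta_bracket del: power_Suc)
  also have "\<dots> = (v \<theta> ^ Suc n) ^ (q ^ Suc n)"
    by (simp add: power_mult_distrib power_mult[symmetric] mult.commute mult.left_commute)
  finally show ?case .
qed (simp add: Dq_0)

text \<open>Stated for a real radius because it serves both for the convergence of e_C and as the
  majorant in \<open>scaled_E_converges\<close>.\<close>

lemma exp_coeff_tendsto_0:
  assumes "R \<ge> 0"
  shows "(\<lambda>n. R ^ (q ^ n) / v (Dq q \<theta> n)) \<longlonglongrightarrow> 0"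
proof -
  have "(\<lambda>n. R * inverse (v \<theta>) ^ n) \<longlonglongrightarrow> R * 0"
    using v_theta_gt_1 by (intro tendsto_mult_left LIMSEQ_power_zero) (simp add: inverse_less_1_iff)
  hence "(\<lambda>n. R / v \<theta> ^ n) \<longlonglongrightarrow> 0" by (simp add: divide_inverse power_inverse)
  hence ev: "\<forall>\<^sub>F n in sequentially. R / v \<theta> ^ n < 1 / 2" by (rule order_tendstoD(2)) simp
  have "\<forall>\<^sub>F n in sequentially. R ^ (q ^ n) / v (Dq q \<theta> n) \<le> (1 / 2) ^ n"
    using ev
  proof eventually_elim
    case (elim n)
    have "R ^ (q ^ n) / v (Dq q \<theta> n) = (R / v \<theta> ^ n) ^ (q ^ n)" by (simp add: v_Dq power_divide)
    also have "\<dots> \<le> (1 / 2) ^ (q ^ n)"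
      using elim assms v_nonneg by (intro power_mono) auto
    also have "\<dots> \<le> (1 / 2) ^ n"
      using q_gt_1 by (intro power_decreasing) (auto intro: less_imp_le power_gt_expt)
    finally show ?case .
  qed
  thus ?thesis
    using assms v_nonneg
    by (intro tendsto_sandwich[OF _ _ tendsto_const LIMSEQ_power_zero[of "1 / 2 :: real"]]) auto
qed

lemma eC_converges: "vconv v (\<lambda>N. \<Sum>j<N. w ^ (q ^ j) / Dq q \<theta> j) (eC v q \<theta> w)"
  unfolding eC_def
  using exp_coeff_tendsto_0[OF v_nonneg[of w]] by (intro vsuminf_converges) (simp add: v_divide v_power)

text \<open>The boundary term of the telescoped series after multiplication by the partial product
  of \<open>omega\<close>.\<close>

definition scaled_E :: "nat \<Rightarrow> 'a \<Rightarrow> 'a" where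
  "scaled_E N z = (\<iota> * \<theta>) ^ (q ^ N) * Ecar q \<theta> N z"

text \<open>The case N = 0 is \<iota>^q = -\<theta> \<iota> times \<theta>^q; the others follow by
  taking q-th powers, which commute with the sign in every characteristic.\<close>

lemma iota_theta_frob: "(\<iota> * \<theta>) ^ (q ^ Suc N) = - (\<theta> ^ (q ^ Suc N)) * (\<iota> * \<theta>) ^ (q ^ N)"
proof (induction N)
  case (Suc N)
  have "(\<iota> * \<theta>) ^ (q ^ Suc (Suc N)) = ((\<iota> * \<theta>) ^ (q ^ Suc N)) ^ q"
    by (simp only: frob_iter_Suc)
  also have "\<dots> = - (\<theta> ^ (q ^ Suc (Suc N))) * ((\<iota> * \<theta>) ^ (q ^ N)) ^ q"
    by (simp only: Suc power_mult_distrib[of "- (\<theta> ^ (q ^ Suc N))"] frob_minus frob_iter_Suc[of \<theta>])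
  also have "((\<iota> * \<theta>) ^ (q ^ N)) ^ q = (\<iota> * \<theta>) ^ (q ^ Suc N)" by (rule frob_iter_Suc)
  finally show ?case .
qed (simp add: power_mult_distrib iota_power_q)

text \<open>\<open>Ecar_Suc\<close> multiplied by -\<kappa>: since \<kappa>^q = -T \<kappa>, the
  term -\<kappa> E^q is (\<kappa> E)^q / T.\<close>

lemma scaled_E_Suc:
  "(1 - \<theta> / \<theta> ^ (q ^ Suc N)) * scaled_E (Suc N) z = scaled_E N z + scaled_E N z ^ q / \<theta> ^ (q ^ Suc N)"
proof -
  define T \<kappa> E E' where "T = \<theta> ^ (q ^ Suc N)" and "\<kappa> = (\<iota> * \<theta>) ^ (q ^ N)"
    and "E = Ecar q \<theta> N z" and "E' = Ecar q \<theta> (Suc N) z"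
  have T: "T \<noteq> 0" by (simp add: T_def)
  have \<kappa>: "\<kappa> ^ q = - T * \<kappa>" "(\<iota> * \<theta>) ^ (q ^ Suc N) = - T * \<kappa>"
    using iota_theta_frob[of N] unfolding T_def \<kappa>_def frob_iter_Suc by simp_all
  have "(T - \<theta>) * E' = E ^ q - E" unfolding T_def E_def E'_def by (rule Ecar_Suc)
  hence "- \<kappa> * ((T - \<theta>) * E') = \<kappa> * E + \<kappa> ^ q * E ^ q / T"
    using T by (simp add: \<kappa>(1) right_diff_distrib)
  moreover have "(1 - \<theta> / T) * (- T * \<kappa> * E') = - \<kappa> * ((T - \<theta>) * E')"
    using T by (simp add: field_simps)
  ultimately show ?thesis
    unfolding scaled_E_def \<kappa>(2) T_def[symmetric] \<kappa>_def[symmetric] E_def[symmetric] E'_def[symmetric]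
      power_mult_distrib[of \<kappa>] by simp
qed

text \<open>The sum satisfies the recursion \<open>scaled_E_Suc\<close>. The term \<open>a i\<close>
  of the sum for N + 1 arises twice: from the i-th term for N, and from the Frobenius of the term
  before it.\<close>

lemma scaled_E_eq_sum: "scaled_E N z = (\<Sum>i\<le>N. (z * pi_part (N - i)) ^ (q ^ i) / Dq q \<theta> i)"
proof (induction N)
  case 0
  show ?case by (simp add: scaled_E_def Ecar_0 Dq_0 pi_part_def)
next
  case (Suc N)
  define T where "T = \<theta> ^ (q ^ Suc N)"
  define a where "a i = (z * pi_part (Suc N - i)) ^ (q ^ i) / Dq q \<theta> i" for i
  have T: "T \<noteq> 0" by (simp add: T_def)
  \<comment> \<open>The factor lost from \<open>pi_part (Suc N - i)\<close> to
    \<open>pi_part (N - i)\<close>, raised to the power q^i.\<close>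
  have 1: "(z * pi_part (N - i)) ^ (q ^ i) / Dq q \<theta> i = a i * (1 - \<theta> ^ (q ^ i) / T)" if "i \<le> N" for i
  proof -
    have "(1 - \<theta> / \<theta> ^ (q ^ (Suc N - i))) ^ (q ^ i) = 1 - \<theta> ^ (q ^ i) / T"
      using that by (simp add: frob_iter_diff power_divide T_def power_mult[symmetric] power_add[symmetric]
        del: power_Suc)
    moreover have "pi_part (N - i) = pi_part (Suc N - i) * (1 - \<theta> / \<theta> ^ (q ^ (Suc N - i)))"
      using pi_part_Suc[of "N - i"] that by (simp only: Suc_diff_le)
    ultimately show ?thesis
      by (simp only: a_def power_mult_distrib) (simp add: mult.assoc)
  qed
  \<comment> \<open>Frobenius moves index i to i + 1, and \<open>Dq_Suc\<close> turns D_i^q into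
    D_{i+1} at the cost of a bracket.\<close>
  have 2: "((z * pi_part (N - i)) ^ (q ^ i) / Dq q \<theta> i) ^ q / T
      = a (Suc i) * ((\<theta> ^ (q ^ Suc i) - \<theta>) / T)" for i
  proof -
    have "((z * pi_part (N - i)) ^ (q ^ i) / Dq q \<theta> i) ^ q = (z * pi_part (N - i)) ^ (q ^ Suc i) / Dq q \<theta> i ^ q"
      by (simp only: power_divide frob_iter_Suc)
    also have "\<dots> = a (Suc i) * (\<theta> ^ (q ^ Suc i) - \<theta>)"
      using theta_bracket_nonzero[of "Suc i"] by (simp add: a_def Dq_Suc del: power_Suc)
    finally show ?thesis by (simp del: power_Suc)
  qed
  have "(1 - \<theta> / T) * scaled_E (Suc N) z
      = (\<Sum>i\<le>N. a i * (1 - \<theta> ^ (q ^ i) / T)) + (\<Sum>i\<le>N. a (Suc i) * ((\<theta> ^ (q ^ Suc i) - \<theta>) / T))"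
    unfolding scaled_E_Suc[of N z, folded T_def] Suc frob_sum sum_divide_distrib 2
    by (intro arg_cong2[where f = "(+)"] sum.cong refl) (simp add: 1)
  \<comment> \<open>Both sums extend to \<open>i \<le> Suc N\<close>: the added factor at \<open>i = Suc N\<close>, resp. \<open>i = 0\<close>, vanishes.\<close>
  also have "(\<Sum>i\<le>N. a i * (1 - \<theta> ^ (q ^ i) / T)) = (\<Sum>i\<le>Suc N. a i * (1 - \<theta> ^ (q ^ i) / T))"
    using T by (simp add: T_def)
  also have "(\<Sum>i\<le>N. a (Suc i) * ((\<theta> ^ (q ^ Suc i) - \<theta>) / T)) = (\<Sum>i\<le>Suc N. a i * ((\<theta> ^ (q ^ i) - \<theta>) / T))"
    unfolding sum.atMost_Suc_shift[of "\<lambda>i. a i * ((\<theta> ^ (q ^ i) - \<theta>) / T)"] by simp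
  \<comment> \<open>The two weights of \<open>a i\<close> add up to 1 - \<theta> / T, which is
    independent of i and nonzero.\<close>
  also have "(\<Sum>i\<le>Suc N. a i * (1 - \<theta> ^ (q ^ i) / T)) + (\<Sum>i\<le>Suc N. a i * ((\<theta> ^ (q ^ i) - \<theta>) / T))
      = (\<Sum>i\<le>Suc N. (1 - \<theta> / T) * a i)"
    unfolding sum.distrib[symmetric] using T by (intro sum.cong refl) (simp add: field_simps)
  also have "\<dots> = (1 - \<theta> / T) * (\<Sum>i\<le>Suc N. a i)" by (simp only: sum_distrib_left)
  finally show ?case
    unfolding T_def a_def using one_minus_theta_quot_nonzero[OF zero_less_Suc, of N]
    by (simp only: mult_left_cancel not_False_eq_True)
qed

text \<open>In \<open>scaled_E_eq_sum\<close> each term tends to the corresponding term of e_C. The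
  differences are bounded uniformly in N because all \<open>pi_part\<close> have the same absolute
  value, which also bounds that of \<open>period\<close>.\<close>

lemma scaled_E_converges: "vconv v (\<lambda>N. scaled_E N z) (eC v q \<theta> (period * z))"
proof -
  define f where "f N i = ((z * pi_part (N - i)) ^ (q ^ i) - (period * z) ^ (q ^ i)) / Dq q \<theta> i" for N i
  define R where "R = v z * v (\<iota> * \<theta>)"
  have R: "R \<ge> 0" by (simp add: R_def v_nonneg)
  have "vconv v (\<lambda>N. \<Sum>i\<le>N. f N i) 0"
  proof (rule vconv_sum_dominated[OF exp_coeff_tendsto_0[OF R]])
    fix N i :: nat
    have "v (z * pi_part (N - i)) \<le> R" "v (period * z) \<le> R"
      using mult_right_mono[OF v_period_le v_nonneg[of z]]
      by (simp_all add: v_mult[of z] v_mult[of period] v_pi_part R_def mult.commute)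
    hence "v (z * pi_part (N - i) - period * z) \<le> R"
      using v_diff[of "z * pi_part (N - i)" "period * z"] by simp
    thus "v (f N i) \<le> R ^ (q ^ i) / v (Dq q \<theta> i)"
      unfolding f_def frob_iter_diff[symmetric] v_divide v_power
      by (intro divide_right_mono power_mono v_nonneg)
  next
    fix i
    have "vconv v (\<lambda>N. pi_part (N - i)) period"
      using pi_part_converges unfolding vconv_def by (rule filterlim_compose[OF _ filterlim_minus_const_nat_at_top])
    hence "(\<lambda>N. (v z * v (pi_part (N - i) - period)) ^ (q ^ i) / v (Dq q \<theta> i)) \<longlonglongrightarrow> (v z * 0) ^ (q ^ i) / v (Dq q \<theta> i)"
      unfolding vconv_def by (intro tendsto_intros) (auto simp: v_eq_0)
    moreover have "v (f N i) = (v z * v (pi_part (N - i) - period)) ^ (q ^ i) / v (Dq q \<theta> i)" for N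
    proof -
      have "f N i = (z * (pi_part (N - i) - period)) ^ (q ^ i) / Dq q \<theta> i"
        unfolding f_def frob_iter_diff[symmetric] by (simp only: right_diff_distrib mult.commute)
      thus ?thesis by (simp only: v_divide v_power v_mult)
    qed
    ultimately show "vconv v (\<lambda>N. f N i) 0" using q_pos by (simp add: vconv_def power_0_left)
  qed
  \<comment> \<open>The shift matches the sum over i \<le> N with the partial sum of N + 1
    terms.\<close>
  from vconv_add[OF this vconv_Suc[OF eC_converges[of "period * z"]]] show ?thesis
    by (simp add: scaled_E_eq_sum f_def diff_divide_distrib sum_subtractf lessThan_Suc_atMost)
qed

subsection \<open>Convergence in the Tate algebra\<close>

abbreviation omega_part :: "nat \<Rightarrow> nat \<Rightarrow> 'a" where
  "omega_part \<equiv> tprod (\<lambda>j. tinv_lin (\<theta> ^ (q ^ j)))"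

lemma v_theta_power_ge_1: "v (\<theta> ^ n) \<ge> 1"
  using v_theta_gt_1 by (simp add: v_power)

lemma v_tinv_lin_le: "v (tinv_lin (\<theta> ^ n) k) \<le> 1"
  using v_theta_power_ge_1[of n] by (simp add: tinv_lin_def v_power v_inverse power_le_one inverse_le_1_iff)

lemma v_omega_part_le: "v (omega_part N k) \<le> 1"
proof (induction N arbitrary: k)
  case (Suc N)
  show ?case unfolding tprod.simps tmult_def v_mult
    by (rule v_sum_le) (auto simp: v_mult intro!: mult_le_one Suc v_tinv_lin_le v_nonneg)
qed (simp add: tone_def)

text \<open>Each coefficient of the new factor other than the constant 1 contains at least one
  inverse of \<theta>^(q^N). The bound is free of k, as convergence in the Gauss norm
  requires.\<close>

lemma v_omega_part_diff:
  "v (\<iota> * omega_part (Suc N) k - \<iota> * omega_part N k) \<le> v \<iota> / v \<theta> ^ (q ^ N)"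
proof -
  define T where "T = \<theta> ^ (q ^ N)"
  have T: "v T \<ge> 1" using v_theta_power_ge_1 by (simp add: T_def)
  have "omega_part (Suc N) k - omega_part N k = (\<Sum>i<k. omega_part N i * inverse T ^ (k - i))"
    by (simp add: tmult_def tinv_lin_def lessThan_Suc_atMost[symmetric] T_def)
  also have "v \<dots> \<le> 1 / v T"
  proof (rule v_sum_le)
    fix i assume "i \<in> {..<k}"
    hence "inverse (v T) ^ (k - i) \<le> inverse (v T) ^ 1"
      using T by (intro power_decreasing) (auto simp: inverse_le_1_iff)
    hence "v (omega_part N i) * inverse (v T) ^ (k - i) \<le> 1 * inverse (v T)"
      using T by (intro mult_mono v_omega_part_le) auto
    thus "v (omega_part N i * inverse T ^ (k - i)) \<le> 1 / v T"
      unfolding v_mult v_power v_inverse by (simp add: inverse_eq_divide)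
  qed (use T in simp)
  finally have "v \<iota> * v (omega_part (Suc N) k - omega_part N k) \<le> v \<iota> * (1 / v T)"
    using v_nonneg by (intro mult_left_mono)
  thus ?thesis by (simp add: T_def v_power right_diff_distrib[symmetric] v_mult del: tprod.simps)
qed

lemma omega_converges: "vconv v (\<lambda>N. \<iota> * omega_part N k) (omega v q \<theta> \<iota> k)"
  unfolding omega_def
  by (rule tconv_imp_vconv[OF tlim_converges[OF inverse_v_theta_tendsto_0 v_omega_part_diff]])

lemma bpoly_Suc: "bpoly q \<theta> (Suc j) = [:- (\<theta> ^ (q ^ j)), 1:] * bpoly q \<theta> j"
  by (simp add: bpoly_def mult.commute)

text \<open>The coefficients of b_j are bounded by the product of the v(\<theta>)^(q^i) for i < j,
  which \<open>iota_theta_frob\<close> rewrites through \<iota> \<theta>. This form makes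
  \<open>scaled_E\<close> appear in the terms b_j E_j.\<close>

lemma v_coeff_bpoly_le:
  "v (coeff (bpoly q \<theta> j) k) * (v \<iota> * v \<theta> ^ (q ^ j)) \<le> v ((\<iota> * \<theta>) ^ (q ^ j))"
proof (induction j arbitrary: k)
  case 0
  show ?case by (cases k) (simp_all add: bpoly_def v_mult v_nonneg)
next
  case (Suc j)
  define T where "T = \<theta> ^ (q ^ j)"
  define c where "c = v \<iota> * v T"
  have c: "c > 0" using v_nonneg[of \<iota>] v_eq_0[of \<iota>] v_theta_power_ge_1[of "q ^ j"]
    by (simp add: c_def T_def)
  have T: "v T \<ge> 1" using v_theta_power_ge_1 by (simp add: T_def)
  have IH: "v (coeff (bpoly q \<theta> j) k) \<le> v ((\<iota> * \<theta>) ^ (q ^ j)) / c" for k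
    using Suc[of k] c by (simp add: c_def T_def v_power pos_le_divide_eq)
  have "coeff (bpoly q \<theta> (Suc j)) k
      = - (T * coeff (bpoly q \<theta> j) k) + (if k = 0 then 0 else coeff (bpoly q \<theta> j) (k - 1))"
    by (cases k) (simp_all add: bpoly_Suc T_def)
  also have "v \<dots> \<le> v T * (v ((\<iota> * \<theta>) ^ (q ^ j)) / c)"
  proof (rule order.trans[OF v_add max.boundedI])
    show "v (- (T * coeff (bpoly q \<theta> j) k)) \<le> v T * (v ((\<iota> * \<theta>) ^ (q ^ j)) / c)"
      using IH v_nonneg by (simp only: v_minus v_mult[of T]) (intro mult_left_mono)
    have "v (if k = 0 then 0 else coeff (bpoly q \<theta> j) (k - 1)) \<le> 1 * (v ((\<iota> * \<theta>) ^ (q ^ j)) / c)"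
      using IH c v_nonneg by auto
    also have "\<dots> \<le> v T * (v ((\<iota> * \<theta>) ^ (q ^ j)) / c)"
      using T c v_nonneg by (intro mult_right_mono) auto
    finally show "v (if k = 0 then 0 else coeff (bpoly q \<theta> j) (k - 1)) \<le> v T * (v ((\<iota> * \<theta>) ^ (q ^ j)) / c)" .
  qed
  also have "\<dots> = v ((\<iota> * \<theta>) ^ (q ^ j)) / v \<iota>" using c T by (simp add: c_def)
  finally have "v (coeff (bpoly q \<theta> (Suc j)) k) * v \<iota> \<le> v ((\<iota> * \<theta>) ^ (q ^ j))"
    using c T v_nonneg[of \<iota>] by (cases "v \<iota> = 0") (auto simp: c_def field_simps)
  hence "v (coeff (bpoly q \<theta> (Suc j)) k) * v \<iota> * v \<theta> ^ (q ^ Suc j)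
      \<le> v ((\<iota> * \<theta>) ^ (q ^ j)) * v \<theta> ^ (q ^ Suc j)"
    using v_nonneg by (intro mult_right_mono zero_le_power)
  thus ?case unfolding iota_theta_frob v_mult[of "- _"] v_minus v_power[of \<theta>] by (simp only: ac_simps)
qed

text \<open>By \<open>v_coeff_bpoly_le\<close> the N-th term is at most
  \<open>v (scaled_E N z)\<close> over \<open>v \<iota> * v \<theta> ^ (q ^ N)\<close>, and
  \<open>scaled_E\<close> is bounded because it converges.\<close>

lemma bEseries_converges:
  "vconv v (\<lambda>N. \<Sum>j<N. coeff (bpoly q \<theta> j) k * Ecar q \<theta> j z) (bEseries v q \<theta> z k)"
proof -
  from scaled_E_converges[of z] obtain B where B: "B > 0" "\<And>N. v (scaled_E N z) \<le> B"
    by (rule vconv_norm_bounded) auto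
  have "v ((\<Sum>j<Suc N. coeff (bpoly q \<theta> j) k * Ecar q \<theta> j z) - (\<Sum>j<N. coeff (bpoly q \<theta> j) k * Ecar q \<theta> j z))
      \<le> (B / v \<iota>) / v \<theta> ^ (q ^ N)" for N k
  proof -
    have pos: "v \<iota> * v \<theta> ^ (q ^ N) > 0"
      using v_nonneg[of \<iota>] v_eq_0[of \<iota>] v_theta_gt_1 by simp
    have "v (coeff (bpoly q \<theta> N) k * Ecar q \<theta> N z) * (v \<iota> * v \<theta> ^ (q ^ N))
        = (v (coeff (bpoly q \<theta> N) k) * (v \<iota> * v \<theta> ^ (q ^ N))) * v (Ecar q \<theta> N z)"
      by (simp only: v_mult ac_simps)
    also have "\<dots> \<le> v ((\<iota> * \<theta>) ^ (q ^ N)) * v (Ecar q \<theta> N z)"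
      by (intro mult_right_mono v_coeff_bpoly_le v_nonneg)
    also have "\<dots> \<le> B" using B(2)[of N] by (simp add: scaled_E_def v_mult)
    finally show ?thesis using pos by (simp add: pos_le_divide_eq)
  qed
  thus ?thesis unfolding bEseries_def
    by (intro tconv_imp_vconv[OF tlim_converges[OF inverse_v_theta_tendsto_0]])
qed

subsection \<open>The functional equation\<close>

text \<open>Moves the finite-level identities into the ring of formal power series.\<close>

lemma Abs_fps_tmult: "Abs_fps (tmult f g) = Abs_fps f * Abs_fps g"
  by (rule fps_ext) (simp add: tmult_def fps_mult_nth atLeast0AtMost)

lemma Abs_fps_tinv_lin: "Abs_fps (tinv_lin a) * (fps_X - fps_const a) = fps_const (- a)" if "a \<noteq> 0"
proof (rule fps_ext)
  fix n
  show "(Abs_fps (tinv_lin a) * (fps_X - fps_const a)) $ n = fps_const (- a) $ n"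
    using that by (cases n) (simp_all add: right_diff_distrib fps_X_mult_right_nth tinv_lin_def)
qed

definition b_fps :: "nat \<Rightarrow> 'a fps" where
  "b_fps j = fps_of_poly (bpoly q \<theta> j)"

lemma b_fps_Suc: "b_fps (Suc j) = b_fps j * (fps_X - fps_const (\<theta> ^ (q ^ j)))"
  by (simp add: b_fps_def bpoly_Suc fps_of_poly_mult fps_of_poly_pCons fps_const_neg[symmetric]
    mult.commute[of "fps_of_poly _"] del: fps_const_neg)

text \<open>Each factor t - T of b_N meets (1 - t/T)^(-1) and leaves the constant -T, so t
  disappears; \<open>iota_theta_frob\<close> collects the constants.\<close>

lemma omega_part_times_b:
  "Abs_fps (omega_part N) * b_fps N * fps_const (\<iota> * \<theta> ^ (q ^ N)) = fps_const ((\<iota> * \<theta>) ^ (q ^ N))"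
proof (induction N)
  case 0
  have "Abs_fps tone = (1 :: 'a fps)" by (rule fps_ext) (simp add: tone_def)
  thus ?case by (simp add: b_fps_def bpoly_def)
next
  case (Suc N)
  define T where "T = \<theta> ^ (q ^ N)"
  define T' where "T' = \<theta> ^ (q ^ Suc N)"
  have "Abs_fps (omega_part (Suc N)) * b_fps (Suc N) * fps_const (\<iota> * T')
      = Abs_fps (omega_part N) * b_fps N * (Abs_fps (tinv_lin T) * (fps_X - fps_const T)) * fps_const (\<iota> * T')"
    by (simp only: tprod.simps Abs_fps_tmult b_fps_Suc T_def ac_simps)
  also have "\<dots> = Abs_fps (omega_part N) * b_fps N * (fps_const (- T) * fps_const (\<iota> * T'))"
    by (subst Abs_fps_tinv_lin) (simp_all only: T_def theta_nonzero power_not_zero not_False_eq_True mult.assoc)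
  also have "fps_const (- T) * fps_const (\<iota> * T') = fps_const (\<iota> * T) * fps_const (- T')"
    by (simp only: fps_const_mult mult_minus_left mult_minus_right ac_simps)
  also have "Abs_fps (omega_part N) * b_fps N * (fps_const (\<iota> * T) * fps_const (- T'))
      = fps_const ((\<iota> * \<theta>) ^ (q ^ N)) * fps_const (- T')"
    by (simp only: Suc[folded T_def, symmetric] mult.assoc)
  also have "\<dots> = fps_const ((\<iota> * \<theta>) ^ (q ^ Suc N))"
    by (simp only: iota_theta_frob fps_const_mult T'_def mult.commute)
  finally show ?case by (simp only: T'_def)
qed

definition bE_fps :: "nat \<Rightarrow> 'a \<Rightarrow> 'a fps" where
  "bE_fps N z = (\<Sum>j<N. b_fps j * fps_const (Ecar q \<theta> j z))"

text \<open>Telescoping: since b_{N+1} = b_N (t - \<theta>^(q^N)), the old boundary term and the E_N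
  part of the new term add up to t b_N E_N(z).\<close>

lemma bE_fps_theta_mult:
  "bE_fps (Suc N) (\<theta> * z) = fps_X * bE_fps N z + b_fps N * fps_const (\<theta> ^ (q ^ N) * Ecar q \<theta> N z)"
proof (induction N)
  case 0
  show ?case by (simp add: bE_fps_def Ecar_0)
next
  case (Suc N)
  define T E where "T = fps_const (\<theta> ^ (q ^ N))" and "E = fps_const (Ecar q \<theta> N z)"
  define R where "R = fps_const (\<theta> ^ (q ^ Suc N) * Ecar q \<theta> (Suc N) z)"
  have "bE_fps (Suc (Suc N)) (\<theta> * z)
      = bE_fps (Suc N) (\<theta> * z) + b_fps (Suc N) * fps_const (Ecar q \<theta> (Suc N) (\<theta> * z))"
    by (simp only: bE_fps_def sum.lessThan_Suc)
  also have "\<dots> = fps_X * bE_fps N z + b_fps N * (T * E) + b_fps (Suc N) * (R + E)"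
    unfolding Suc Ecar_theta_mult T_def E_def R_def fps_const_mult fps_const_add ..
  also have "\<dots> = fps_X * (bE_fps N z + b_fps N * E) + b_fps (Suc N) * R"
    by (simp add: b_fps_Suc T_def[symmetric] algebra_simps)
  also have "bE_fps N z + b_fps N * E = bE_fps (Suc N) z"
    by (simp only: bE_fps_def sum.lessThan_Suc E_def)
  finally show ?case by (simp only: R_def)
qed

text \<open>Two indices, because the telescoped identity compares N + 1 terms at \<theta> z with N
  terms at z under the same partial product.\<close>

definition omega_bE_part :: "nat \<Rightarrow> nat \<Rightarrow> 'a \<Rightarrow> 'a fps" where
  "omega_bE_part N M z = fps_const \<iota> * Abs_fps (omega_part N) * bE_fps M z"

lemma omega_bE_part_theta_mult:
  "omega_bE_part N (Suc N) (\<theta> * z) = fps_X * omega_bE_part N N z + fps_const (scaled_E N z)"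
proof -
  define E where "E = fps_const (Ecar q \<theta> N z)"
  have "omega_bE_part N (Suc N) (\<theta> * z) = fps_X * omega_bE_part N N z
      + Abs_fps (omega_part N) * b_fps N * fps_const (\<iota> * \<theta> ^ (q ^ N)) * E"
    by (simp add: omega_bE_part_def bE_fps_theta_mult E_def fps_const_mult[symmetric] algebra_simps
      del: fps_const_mult)
  thus ?thesis
    unfolding omega_part_times_b by (simp only: E_def fps_const_mult scaled_E_def)
qed

text \<open>A coefficient of a product is a finite sum, so coefficientwise limits suffice;
  \<open>M\<close> allows both N and N + 1 terms.\<close>

lemma omega_bE_part_nth_converges:
  assumes "\<And>k. vconv v (\<lambda>N. bE_fps (M N) z $ k) (bEseries v q \<theta> z k)"
  shows "vconv v (\<lambda>N. omega_bE_part N (M N) z $ k) (tmult (omega v q \<theta> \<iota>) (bEseries v q \<theta> z) k)"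
proof -
  have "omega_bE_part N (M N) z $ k = (\<Sum>i\<le>k. (\<iota> * omega_part N i) * bE_fps (M N) z $ (k - i))" for N
    by (simp add: omega_bE_part_def fps_mult_nth[of "fps_const \<iota> * _"] atLeast0AtMost)
  thus ?thesis unfolding tmult_def by (simp, intro vconv_sum vconv_mult omega_converges assms)
qed

lemma bE_fps_nth_converges: "vconv v (\<lambda>N. bE_fps N z $ k) (bEseries v q \<theta> z k)"
  using bEseries_converges[of k z] by (simp add: bE_fps_def b_fps_def fps_sum_nth)

text \<open>Both sides are limits of the same sequence: multiplication by t shifts coefficients, and
  the boundary term contributes only to the constant one.\<close>

lemma omega_bEseries_theta_mult:
  "tmult (omega v q \<theta> \<iota>) (bEseries v q \<theta> (\<theta> * z)) k =
    (if k = 0 then eC v q \<theta> (period * z) else tmult (omega v q \<theta> \<iota>) (bEseries v q \<theta> z) (k - 1))"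
proof (rule vconv_unique)
  show "vconv v (\<lambda>N. omega_bE_part N (Suc N) (\<theta> * z) $ k)
    (tmult (omega v q \<theta> \<iota>) (bEseries v q \<theta> (\<theta> * z)) k)"
    by (intro omega_bE_part_nth_converges vconv_Suc bE_fps_nth_converges)
  show "vconv v (\<lambda>N. omega_bE_part N (Suc N) (\<theta> * z) $ k)
    (if k = 0 then eC v q \<theta> (period * z) else tmult (omega v q \<theta> \<iota>) (bEseries v q \<theta> z) (k - 1))"
    using scaled_E_converges[of z] omega_bE_part_nth_converges[OF bE_fps_nth_converges, of z "k - 1"]
    by (cases k) (simp_all add: omega_bE_part_theta_mult)
qed

text \<open>Replacing z by z / \<theta> lowers k by one, hence the induction over arbitrary z; it
  ends at e_C(\<open>period\<close> z / \<theta>), the constant coefficient of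
  \<open>fC\<close>.\<close>

lemma fC_period_eq: "fC v q \<theta> (period * z) k = tmult (omega v q \<theta> \<iota>) (bEseries v q \<theta> z) k"
proof (induction k arbitrary: z)
  case 0
  show ?case using omega_bEseries_theta_mult[of "z / \<theta>" 0] by (simp add: fC_def)
next
  case (Suc k)
  show ?case using omega_bEseries_theta_mult[of "z / \<theta>" "Suc k"] Suc[of "z / \<theta>"] by (simp add: fC_def)
qed

end

theorem theorem2p10:
  fixes v :: "'a::field \<Rightarrow> real" and p q :: nat and \<theta> \<iota> z :: 'a
  assumes "prime p" and "\<exists>n>0. q = p ^ n" and "of_nat p = (0::'a)"
    and "is_nonarch_abs v" and "vcomplete v"
    and "\<forall>P::'a poly. degree P > 0 \<longrightarrow> (\<exists>x. poly P x = 0)"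
    and "\<forall>x e. e > 0 \<longrightarrow> (\<exists>y. algebraic_over (A_elems q \<theta>) y \<and> v (x - y) < e)"
    and "v \<theta> = real q"
    and "\<iota> ^ (q - 1) = - \<theta>"
  shows "fC v q \<theta> (pitilde v q \<theta> \<iota> * z) = tmult (omega v q \<theta> \<iota>) (bEseries v q \<theta> z)"
proof -
  interpret carlitz v p q \<theta> \<iota>
    using assms by unfold_locales auto
  show ?thesis by (intro ext fC_period_eq)
qed

end
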